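(* Let $d$ be a positive even integer with $m\ge 3$ distinct prime factors. Then $M(d)\le 2^{m+1}+1$. Furthermore, if $d$ is square-free, then $M(d)\le 13$ when $m=3$, and $M(d)\le 2^{m+1}+7-4m$ when $m\ge 4$.
   Context: A pair $(a,b)\in\mathbb{Z}^2$ is multiplicatively dependent if $ab\neq 0$ and there is $(k_1,k_2)\in\mathbb{Z}^2\setminus\{(0,0)\}$ with $a^{k_1}b^{k_2}=1$. For $d\in\mathbb{Z}$, $\mathcal{M}(d)$ is the set of multiplicatively dependent pairs $(a,b)\in\mathbb{Z}^2$ with $ab\ne0$ and $b-a=d$, and $M(d)=|\mathcal{M}(d)|$. *)

theory Defs
  imports "HOL-Computational_Algebra.Computational_Algebra"
begin

(* The exponents may be negative, so the relation is evaluated in the rationals. *)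
definition mult_dependent :: "int \<Rightarrow> int \<Rightarrow> bool" where
  "mult_dependent a b \<longleftrightarrow>
     a * b \<noteq> 0 \<and>
     (\<exists>k1 k2 :: int. (k1, k2) \<noteq> (0, 0) \<and>
        (of_int a :: rat) powi k1 * (of_int b :: rat) powi k2 = 1)"

definition mult_dep_pairs :: "int \<Rightarrow> (int \<times> int) set" where
  "mult_dep_pairs d = {(a, b). mult_dependent a b \<and> a * b \<noteq> 0 \<and> b - a = d}"

(* card is 0 on infinite sets, so a bound on M d is only meaningful together with
   finiteness of mult_dep_pairs d. *)
definition M :: "int \<Rightarrow> nat" where
  "M d = card (mult_dep_pairs d)"

end

theory Submission
  imports Defs
begin

text \<open>
  Apart from the five pairs with \<open>\<bar>a\<bar> = 1\<close>, \<open>\<bar>b\<bar> = 1\<close> or \<open>a = - b\<close>, the symmetry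
  \<open>(a, b) \<mapsto> (- b, - a)\<close> reduces the count to pairs with \<open>1 < \<bar>a\<bar> < \<bar>b\<bar>\<close>. Dependence then
  forces \<open>b = \<bar>a\<bar> u\<close> with \<open>u\<close> having the same prime divisors as \<open>a\<close>, so \<open>d = \<bar>a\<bar> (u \<mp> 1)\<close> and
  \<open>\<bar>a\<bar>\<close> is a unitary divisor of \<open>d\<close> other than \<open>1\<close> and \<open>d\<close>. As \<open>m \<ge> 3\<close>, the divisor \<open>\<bar>a\<bar>\<close>
  determines the sign, so there are at most \<open>2\<^sup>m - 2\<close> such pairs. If \<open>d\<close> is square-free, then
  \<open>\<bar>a\<bar>\<close> divides \<open>u\<close>, so the complementary divisor is at least \<open>\<bar>a\<bar> - 1\<close>; hence \<open>\<bar>a\<bar>\<close> is the smaller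
  member of its complementary pair unless \<open>d = \<bar>a\<bar> (\<bar>a\<bar> - 1)\<close>, which leaves at most \<open>2\<^sup>m\<^sup>-\<^sup>1\<close> pairs.
\<close>

section \<open>Sets to be counted, and prime divisors of integers\<close>

definition ordered_dep_pairs :: "int \<Rightarrow> (int \<times> int) set" where
  "ordered_dep_pairs d = {(a, b). mult_dependent a b \<and> b - a = d \<and> 1 < \<bar>a\<bar> \<and> \<bar>a\<bar> < \<bar>b\<bar>}"

definition proper_unitary_divisors :: "int \<Rightarrow> int set" where
  "proper_unitary_divisors d = {A. 1 < A \<and> (\<exists>e>1. d = A * e \<and> coprime A e)}"

lemma int_prime_divisor_exists:
  fixes A :: int
  assumes "1 < A"
  obtains p where "prime p" "p dvd A"
  using assms prime_divisor_exists[of A] by auto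

lemma int_not_coprime_prime_divisor:
  fixes A e :: int
  assumes "\<not> coprime A e" "A \<noteq> 0"
  obtains p where "prime p" "p dvd A" "p dvd e"
  using assms prime_divisor_exists[of "gcd A e"] by (auto simp: coprime_iff_gcd_eq_1)

section \<open>Multiplicative dependence as an equality of powers\<close>

lemma mult_dependent_commute: "mult_dependent a b \<longleftrightarrow> mult_dependent b a"
  unfolding mult_dependent_def by (metis Pair_inject mult.commute)

text \<open>Doubling the exponents squares the relation, and even exponents absorb the
  signs.\<close>

lemma mult_dependent_uminus:
  assumes "mult_dependent a b"
  shows "mult_dependent (- a) (- b)"
proof -
  obtain k l where kl: "(k, l) \<noteq> (0, 0)" "(of_int a :: rat) powi k * of_int b powi l = 1"
    and ab: "a * b \<noteq> 0"
    using assms by (auto simp: mult_dependent_def)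
  have neg: "(- x :: rat) powi (2 * i) = (x powi i)\<^sup>2" for x i
    by (simp add: power_int_mult power2_eq_square flip: power_int_mult_distrib)
  have "(of_int (- a) :: rat) powi (2 * k) * of_int (- b) powi (2 * l)
      = (of_int a powi k * of_int b powi l)\<^sup>2"
    by (simp add: neg power_mult_distrib)
  then show ?thesis
    using kl ab unfolding mult_dependent_def
    by (intro conjI exI[of _ "2 * k"] exI[of _ "2 * l"]) auto
qed

text \<open>Both absolute values exceed 1, so exponents of equal sign cannot balance. The relation
  thus becomes an equality of powers, where the larger base needs the smaller exponent.\<close>

lemma mult_dependent_imp_power_eq:
  assumes dep: "mult_dependent a b" and a: "1 < \<bar>a\<bar>" and b: "\<bar>a\<bar> < \<bar>b\<bar>"
  obtains k l :: nat where "0 < l" "l < k" "\<bar>a\<bar> ^ k = \<bar>b\<bar> ^ l"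
proof -
  note goal_rule = that
  define x y :: rat where "x = of_int \<bar>a\<bar>" and "y = of_int \<bar>b\<bar>"
  have xy: "1 < x" "x < y" "1 < y" using a b by (auto simp: x_def y_def)
  obtain k l where kl: "(k, l) \<noteq> (0, 0)" "(of_int a :: rat) powi k * of_int b powi l = 1"
    using dep by (auto simp: mult_dependent_def)
  from kl(2) have "\<bar>(of_int a :: rat) powi k * of_int b powi l\<bar> = 1" by simp
  then have eq: "x powi k * y powi l = 1"
    by (simp add: x_def y_def abs_mult power_int_abs)
  have same_sign: False if "(k', l') \<noteq> (0, 0)" "x ^ k' * y ^ l' = 1" for k' l' :: nat
  proof -
    have "1 \<le> x ^ k'" "1 \<le> y ^ l'" using xy by simp_all
    moreover have "1 < x ^ k' \<or> 1 < y ^ l'"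
      using that(1) xy one_less_power[of x k'] one_less_power[of y l'] by (cases "k' = 0") auto
    ultimately have "1 < x ^ k' * y ^ l'"
      by (metis less_1_mult mult.right_neutral mult_1 order_le_less)
    with that show False by simp
  qed
  have opposite: thesis if kl': "(k', l') \<noteq> (0, 0)" "x ^ k' = y ^ l'" for k' l' :: nat
  proof -
    have pw: "\<bar>a\<bar> ^ k' = \<bar>b\<bar> ^ l'"
      using kl'(2) unfolding x_def y_def of_int_power[symmetric] of_int_eq_iff .
    have "0 < l'"
      using kl' xy one_less_power[of x k'] by (cases "l' = 0") auto
    moreover have "l' < k'"
    proof (rule ccontr)
      assume "\<not> l' < k'"
      then have "x ^ k' \<le> x ^ l'" using xy by (intro power_increasing) auto
      also have "\<dots> < y ^ l'" using xy \<open>0 < l'\<close> by (intro power_strict_mono) auto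
      finally show False using kl' by simp
    qed
    ultimately show thesis using pw by (rule goal_rule)
  qed
  have nz: "x \<noteq> 0" "y \<noteq> 0" using xy by auto
  consider (pp) "k \<ge> 0" "l \<ge> 0" | (nn) "k \<le> 0" "l \<le> 0" | (pn) "k \<ge> 0" "l \<le> 0"
    | (np) "k \<le> 0" "l \<ge> 0" by linarith
  then show thesis
  proof cases
    case pp
    then show ?thesis using eq kl(1) same_sign[of "nat k" "nat l"]
      by (auto simp: power_int_def)
  next
    case nn
    obtain k' l' :: nat where "k = - int k'" "l = - int l'" using nn by (metis neg_int_cases nonpos_int_cases)
    then show ?thesis using eq kl(1) same_sign[of k' l'] nz
      by (auto simp: power_int_minus field_simps)
  next
    case pn
    obtain k' l' :: nat where "k = int k'" "l = - int l'" using pn by (metis nonneg_int_cases nonpos_int_cases)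
    then show ?thesis using eq kl(1) opposite[of k' l'] nz
      by (auto simp: power_int_minus field_simps)
  next
    case np
    obtain k' l' :: nat where "k = - int k'" "l = int l'" using np by (metis nonneg_int_cases nonpos_int_cases)
    then show ?thesis using eq kl(1) opposite[of k' l'] nz
      by (auto simp: power_int_minus field_simps)
  qed
qed

section \<open>Cofactors of ordered pairs\<close>

text \<open>Since \<open>l < k\<close> in the power equality, \<open>\<bar>a\<bar> ^ l\<close>
  divides \<open>\<bar>b\<bar> ^ l\<close>, so \<open>\<bar>a\<bar>\<close> divides
  \<open>b\<close>. Cancelling leaves \<open>\<bar>a\<bar> ^ (k - l) = u ^ l\<close> with positive
  exponents, so the prime divisors agree.\<close>

lemma ordered_dep_pairs_structure:
  assumes "(a, b) \<in> ordered_dep_pairs d" and "0 < d"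
  obtains u where "1 < u" "b = \<bar>a\<bar> * u" "d = \<bar>a\<bar> * (u - sgn a)"
    "\<And>p. prime p \<Longrightarrow> p dvd \<bar>a\<bar> \<longleftrightarrow> p dvd u"
proof -
  have ab: "mult_dependent a b" "b - a = d" "1 < \<bar>a\<bar>" "\<bar>a\<bar> < \<bar>b\<bar>"
    using assms by (auto simp: ordered_dep_pairs_def)
  have "0 < b" using ab assms(2) by linarith
  obtain k l :: nat where kl: "0 < l" "l < k" "\<bar>a\<bar> ^ k = \<bar>b\<bar> ^ l"
    using mult_dependent_imp_power_eq[OF ab(1,3,4)] .
  have "\<bar>a\<bar> ^ l dvd \<bar>b\<bar> ^ l"
    using kl by (metis le_imp_power_dvd less_imp_le)
  then have "\<bar>a\<bar> dvd \<bar>b\<bar>" using kl(1) by (simp del: abs_dvd_iff dvd_abs_iff add: pow_divides_pow_iff)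
  then obtain u where u: "b = \<bar>a\<bar> * u" using \<open>0 < b\<close> by (metis abs_of_pos dvdE)
  have "1 < u"
  proof -
    have "\<bar>a\<bar> * 1 < \<bar>a\<bar> * u" using ab(4) \<open>0 < b\<close> u by simp
    then show ?thesis using ab(3) by (subst (asm) mult_less_cancel_left_pos) auto
  qed
  moreover have "d = \<bar>a\<bar> * (u - sgn a)"
    using ab(2) u by (simp add: right_diff_distrib abs_mult_sgn)
  moreover have "p dvd \<bar>a\<bar> \<longleftrightarrow> p dvd u" if "prime p" for p
  proof -
    have "\<bar>a\<bar> ^ l * \<bar>a\<bar> ^ (k - l) = \<bar>a\<bar> ^ l * u ^ l"
      using kl u \<open>0 < b\<close> by (simp add: power_mult_distrib flip: power_add)
    then have "\<bar>a\<bar> ^ (k - l) = u ^ l" using ab(3) by auto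
    then show ?thesis using kl that
      by (metis prime_dvd_power_iff zero_less_diff)
  qed
  ultimately show thesis using u that by blast
qed

text \<open>Of two even numbers differing by 2, one is not divisible by 4; if it is a power of 2,
  this determines it.\<close>

lemma int_eq_two_if_prime_divisors_two:
  fixes v :: int
  assumes "1 < v" and "\<And>p. prime p \<Longrightarrow> p dvd v \<Longrightarrow> p = 2" and "\<not> 4 dvd v"
  shows "v = 2"
proof -
  obtain p where "prime p" "p dvd v" using assms(1) by (rule int_prime_divisor_exists)
  then obtain w where w: "v = 2 * w" using assms(2) by (auto elim: dvdE)
  have "w = 1"
  proof (rule ccontr)
    assume "w \<noteq> 1"
    then have "\<not> is_unit w" "w \<noteq> 0" using w assms(1) by auto
    then obtain q where "prime q" "q dvd w" using prime_divisor_exists by blast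
    then have "2 dvd w" using assms(2)[of q] w by auto
    then show False using assms(3) w by auto
  qed
  with w show ?thesis by simp
qed

text \<open>Turns degenerate cofactors into contradictions with three distinct primes.\<close>

lemma two_small_prime_factors:
  fixes d A e :: int
  assumes "d = A * e" "d \<noteq> 0" "\<And>p. prime p \<Longrightarrow> p dvd A \<Longrightarrow> p = 2"
    and "\<And>p. prime p \<Longrightarrow> p dvd e \<Longrightarrow> p = 3"
  shows "card (prime_factors d) < 3"
proof -
  have "prime_factors d \<subseteq> {2, 3}"
    using assms by (auto simp: prime_factors_dvd prime_dvd_mult_iff)
  then have "card (prime_factors d) \<le> card {2, 3 :: int}" by (intro card_mono) auto
  then show ?thesis by simp
qed

text \<open>A common prime of \<open>\<bar>a\<bar>\<close> and \<open>u - sgn a\<close> would divide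
  \<open>u\<close>, hence the unit \<open>sgn a\<close>.\<close>

lemma ordered_dep_pairs_unitary:
  assumes "(a, b) \<in> ordered_dep_pairs d" "0 < d" "3 \<le> card (prime_factors d)"
  shows "\<bar>a\<bar> \<in> proper_unitary_divisors d"
proof -
  have a: "1 < \<bar>a\<bar>" using assms by (auto simp: ordered_dep_pairs_def)
  obtain u where u: "1 < u" "b = \<bar>a\<bar> * u" "d = \<bar>a\<bar> * (u - sgn a)"
    "\<And>p. prime p \<Longrightarrow> p dvd \<bar>a\<bar> \<longleftrightarrow> p dvd u"
    using ordered_dep_pairs_structure[OF assms(1,2)] by blast
  have s: "sgn a = 1 \<or> sgn a = -1" using a by (auto simp: sgn_if)
  have "coprime \<bar>a\<bar> (u - sgn a)"
  proof (rule ccontr)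
    assume "\<not> ?thesis"
    then obtain p where p: "prime p" "p dvd \<bar>a\<bar>" "p dvd u - sgn a"
      using a by (elim int_not_coprime_prime_divisor) auto
    then have "p dvd u" using u by blast
    then have "p dvd u - (u - sgn a)" using p by (metis dvd_diff)
    then have "is_unit p" using s by auto
    then show False using p by (metis not_prime_unit)
  qed
  moreover have "1 < u - sgn a"
  proof (rule ccontr)
    assume "\<not> ?thesis"
    \<comment> \<open>Only \<open>u = 2\<close> with \<open>a > 0\<close> leaves the cofactor 1;
      then \<open>d = \<bar>a\<bar>\<close> has no prime divisor but 2.\<close>
    then have u2: "u = 2" "d = \<bar>a\<bar> * 1" using u(1,3) s by auto
    have "card (prime_factors d) < 3"
    proof (rule two_small_prime_factors[OF u2(2)])
      show "p = 2" if "prime p" "p dvd \<bar>a\<bar>" for p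
        using that u(4)[of p] u2(1) primes_dvd_imp_eq[of p 2] by simp
    qed (use assms(2) in \<open>auto dest: not_prime_unit\<close>)
    then show False using assms by simp
  qed
  ultimately show ?thesis using a u(3) by (auto simp: proper_unitary_divisors_def)
qed

lemma inj_on_abs_fst_ordered_dep_pairs:
  assumes d: "0 < d" "3 \<le> card (prime_factors d)"
  shows "inj_on (\<lambda>(a, b). \<bar>a\<bar>) (ordered_dep_pairs d)"
proof -
  \<comment> \<open>Both signs for the same \<open>\<bar>a\<bar>\<close> give cofactors \<open>u, v\<close> with the same prime divisors
    and \<open>u = v + 2\<close>, which forces \<open>v = 2\<close>, \<open>u = 4\<close> and \<open>d = 3 \<cdot> 2\<^sup>x\<close>.\<close>
  have no_both: False
    if P: "(a, b) \<in> ordered_dep_pairs d" "(- a, b') \<in> ordered_dep_pairs d" "0 < a" for a b b'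
  proof -
    obtain u where u: "1 < u" "d = a * (u - 1)" "\<And>p. prime p \<Longrightarrow> p dvd a \<longleftrightarrow> p dvd u"
      using ordered_dep_pairs_structure[OF P(1) d(1)] P(3) by auto
    obtain v where v: "1 < v" "d = a * (v + 1)" "\<And>p. prime p \<Longrightarrow> p dvd a \<longleftrightarrow> p dvd v"
      using ordered_dep_pairs_structure[OF P(2) d(1)] P(3) by auto
    have uv: "u = v + 2" using u(2) v(2) P(3) by simp
    have two: "p = 2" if "prime p" "p dvd a" for p
    proof -
      have "p dvd u" "p dvd v" using that u(3) v(3) by blast+
      then have "p dvd 2" using uv by (metis dvd_add_right_iff)
      then show ?thesis using that primes_dvd_imp_eq[of p 2] by simp
    qed
    have "v = 2"
    proof (cases "4 dvd v")
      case True
      then have "\<not> 4 dvd u" using uv by presburger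
      then have "u = 2" using u(1,3) two by (metis int_eq_two_if_prime_divisors_two)
      \<comment> \<open>This case is contradictory: \<open>u = 2\<close> gives \<open>v = 0\<close>,
        against \<open>1 < v\<close>.\<close>
      then show ?thesis using uv v by simp
    next
      case False
      then show ?thesis using v(1,3) two by (metis int_eq_two_if_prime_divisors_two)
    qed
    have "p = 3" if "prime p" "p dvd 3" for p :: int
      using that primes_dvd_imp_eq[of p 3] by simp
    moreover have "d = a * 3" "d \<noteq> 0" using v(2) \<open>v = 2\<close> d(1) by auto
    ultimately have "card (prime_factors d) < 3"
      using two two_small_prime_factors[of d a 3] by blast
    then show False using d by simp
  qed
  show ?thesis
  proof (rule inj_onI, clarify)
    fix a b a' b'
    assume P: "(a, b) \<in> ordered_dep_pairs d" "(a', b') \<in> ordered_dep_pairs d" "\<bar>a\<bar> = \<bar>a'\<bar>"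
    have "a = a'"
    proof (rule ccontr)
      assume "a \<noteq> a'"
      then have "a' = - a" "a \<noteq> 0" using P(3) by auto
      then show False
        using P no_both[of a b b'] no_both[of a' b' b] by (cases "0 < a") auto
    qed
    then show "a = a' \<and> b = b'" using P by (auto simp: ordered_dep_pairs_def)
  qed
qed

section \<open>Unitary divisors and the general count\<close>

text \<open>A unitary divisor is determined by its primes: if \<open>A\<close> and \<open>B\<close>
  share them and \<open>d = B * e\<close>, then \<open>A\<close> is coprime to \<open>e\<close> and
  so divides \<open>B\<close>. The empty and the full set of primes do not occur.\<close>

lemma card_proper_unitary_divisors_le:
  assumes d: "0 < d" "prime_factors d \<noteq> {}"
  shows "finite (proper_unitary_divisors d)"
    and "card (proper_unitary_divisors d) \<le> 2 ^ card (prime_factors d) - 2"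
proof -
  let ?U = "proper_unitary_divisors d"
  have dvd: "A dvd B"
    if AB: "A \<in> ?U" "B \<in> ?U" "prime_factors A = prime_factors B" for A B
  proof -
    obtain e where e: "d = B * e" "coprime B e"
      using AB(2) unfolding proper_unitary_divisors_def by blast
    have pos: "0 < A" "0 < B" using that by (auto simp: proper_unitary_divisors_def)
    have "coprime A e"
    proof (rule ccontr)
      assume "\<not> ?thesis"
      then obtain p where p: "prime p" "p dvd A" "p dvd e"
        using pos by (elim int_not_coprime_prime_divisor) auto
      then have "p dvd B" using that(3) pos
        by (metis in_prime_factors_iff less_irrefl prime_factors_dvd)
      then show False using p e by (metis coprime_common_divisor not_prime_unit)
    qed
    moreover have "A dvd B * e" using that e by (auto simp: proper_unitary_divisors_def)
    ultimately show ?thesis by (simp add: coprime_dvd_mult_left_iff)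
  qed
  have inj: "inj_on prime_factors ?U"
  proof (rule inj_onI)
    fix A B assume "A \<in> ?U" "B \<in> ?U" "prime_factors A = prime_factors B"
    then show "A = B" using dvd[of A B] dvd[of B A]
      by (intro zdvd_antisym_nonneg) (auto simp: proper_unitary_divisors_def)
  qed
  let ?T = "Pow (prime_factors d) - {{}, prime_factors d}"
  have img: "prime_factors ` ?U \<subseteq> ?T"
  proof
    fix S assume "S \<in> prime_factors ` ?U"
    then obtain A e where A: "S = prime_factors A" "1 < A" "1 < e" "d = A * e" "coprime A e"
      by (auto simp: proper_unitary_divisors_def)
    obtain p where p: "prime p" "p dvd A" using A int_prime_divisor_exists by blast
    obtain q where q: "prime q" "q dvd e" using A int_prime_divisor_exists by blast
    have "\<not> q dvd A" using q A by (metis coprime_common_divisor not_prime_unit)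
    then have "q \<notin> S" "q \<in> prime_factors d" "p \<in> S" "S \<subseteq> prime_factors d"
      using A p q by (auto simp: prime_factors_dvd)
    then show "S \<in> ?T" by auto
  qed
  show "finite ?U" using inj img by (rule inj_on_finite) simp
  have "card ?U \<le> card ?T" using inj img by (rule card_inj_on_le) simp
  also have "card ?T = 2 ^ card (prime_factors d) - card {{}, prime_factors d}"
    by (subst card_Diff_subset) (auto simp: card_Pow)
  \<comment> \<open>The two removed sets are distinct because \<open>d\<close> has a prime
    divisor.\<close>
  also have "card {{}, prime_factors d} = 2" using d(2) by (metis card_2_iff)
  finally show "card ?U \<le> 2 ^ card (prime_factors d) - 2" .
qed

text \<open>Each prime of \<open>A\<close> has multiplicity at most 1 in \<open>A\<close> and at
  least 1 in \<open>u\<close>.\<close>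

lemma squarefree_dvd_if_prime_divisors_dvd:
  fixes A u :: int
  assumes "squarefree A" "u \<noteq> 0" "\<And>p. prime p \<Longrightarrow> p dvd A \<Longrightarrow> p dvd u"
  shows "A dvd u"
proof (rule multiplicity_le_imp_dvd)
  show A: "A \<noteq> 0" using assms(1) by auto
  fix p :: int assume p: "prime p"
  show "multiplicity p A \<le> multiplicity p u"
  proof (cases "p dvd A")
    case True
    have "multiplicity p A \<le> 1"
      using assms(1) p A squarefree_factorial_semiring'' by blast
    also have "1 \<le> multiplicity p u"
      using assms(2) assms(3)[OF p True] p by (intro multiplicity_geI) (auto dest: not_prime_unit)
    finally show ?thesis .
  next
    case False
    then show ?thesis by (simp add: not_dvd_imp_multiplicity_0)
  qed
qed

lemma card_ordered_dep_pairs_le: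
  assumes "0 < d" "3 \<le> card (prime_factors d)"
  shows "finite (ordered_dep_pairs d)"
    and "card (ordered_dep_pairs d) \<le> 2 ^ card (prime_factors d) - 2"
proof -
  have ne: "prime_factors d \<noteq> {}" using assms(2) by auto
  note U = card_proper_unitary_divisors_le[OF assms(1) ne]
  note inj = inj_on_abs_fst_ordered_dep_pairs[OF assms]
  have img: "(\<lambda>(a, b). \<bar>a\<bar>) ` ordered_dep_pairs d \<subseteq> proper_unitary_divisors d"
    using ordered_dep_pairs_unitary[OF _ assms] by auto
  show "finite (ordered_dep_pairs d)" using inj img U(1) by (rule inj_on_finite)
  show "card (ordered_dep_pairs d) \<le> 2 ^ card (prime_factors d) - 2"
    using card_inj_on_le[OF inj img U(1)] U(2) by (rule order_trans)
qed

section \<open>The square-free count\<close>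

lemma card_ordered_dep_pairs_squarefree_le:
  assumes "0 < d" "3 \<le> card (prime_factors d)" "squarefree d"
  shows "2 * card (ordered_dep_pairs d) \<le> 2 ^ card (prime_factors d)"
proof -
  have ne: "prime_factors d \<noteq> {}" using assms(2) by auto
  note U = card_proper_unitary_divisors_le[OF assms(1) ne]
  note inj = inj_on_abs_fst_ordered_dep_pairs[OF assms(1,2)]
  let ?U = "proper_unitary_divisors d"
  define Q where "Q = {A \<in> ?U. A < d div A}"
  \<comment> \<open>The borderline case \<open>u = \<bar>a\<bar>\<close> with \<open>a > 0\<close>,
    where the cofactor falls just below \<open>\<bar>a\<bar>\<close>.\<close>
  define R where "R = {A :: int. 1 < A \<and> d = A * (A - 1)}"
  have U_D: "1 < A \<and> 1 < d div A \<and> d = A * (d div A) \<and> coprime A (d div A)" if "A \<in> ?U" for A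
    using that by (auto simp: proper_unitary_divisors_def)
  have finQ: "finite Q" using U(1) by (simp add: Q_def)
  have twoQ: "2 * card Q \<le> card ?U"
  proof -
    have "inj_on ((div) d) Q"
    proof (rule inj_onI)
      fix A B assume "A \<in> Q" "B \<in> Q" "d div A = d div B"
      then show "A = B" using U_D[of A] U_D[of B] unfolding Q_def
        by (metis (no_types, lifting) mem_Collect_eq mult_right_cancel not_one_less_zero)
    qed
    then have "card ((div) d ` Q) = card Q" by (rule card_image)
    moreover have "(div) d ` Q \<subseteq> ?U"
    proof clarify
      fix A assume "A \<in> Q"
      then have *: "1 < A" "1 < d div A" "d = A * (d div A)" "coprime A (d div A)"
        using U_D[of A] by (auto simp: Q_def)
      then show "d div A \<in> ?U"
        unfolding proper_unitary_divisors_def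
        by (intro CollectI conjI exI[of _ A]) (simp_all add: coprime_commute mult.commute)
    qed
    \<comment> \<open>Complementing twice returns \<open>A\<close>, so an overlap would need both
      strict inequalities at once.\<close>
    moreover have "Q \<inter> (div) d ` Q = {}"
    proof -
      have "d div (d div A) = A" if "A \<in> Q" for A
        using U_D[of A] that unfolding Q_def
        by (metis (no_types, lifting) mem_Collect_eq nonzero_mult_div_cancel_right not_one_less_zero)
      then show ?thesis by (force simp: Q_def)
    qed
    ultimately have "card Q + card Q \<le> card ?U"
      using finQ U(1) card_Un_disjoint[of Q "(div) d ` Q"] card_mono[of ?U "Q \<union> (div) d ` Q"]
      by (auto simp: Q_def)
    then show ?thesis by simp
  qed
  have R1: "finite R \<and> card R \<le> 1"
  proof -
    have "A = B" if "A \<in> R" "B \<in> R" for A B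
    proof -
      have *: "1 < A" "1 < B" "A * (A - 1) = B * (B - 1)" using that by (auto simp: R_def)
      then have "(A - B) * (A + B - 1) = 0" by (simp add: algebra_simps)
      then show ?thesis using * by auto
    qed
    then have "R = {} \<or> (\<exists>A. R = {A})" by blast
    then show ?thesis by auto
  qed
  have img: "(\<lambda>(a, b). \<bar>a\<bar>) ` ordered_dep_pairs d \<subseteq> Q \<union> R"
  proof clarify
    fix a b assume P: "(a, b) \<in> ordered_dep_pairs d" and "\<bar>a\<bar> \<notin> R"
    have aU: "\<bar>a\<bar> \<in> ?U" using ordered_dep_pairs_unitary[OF P assms(1,2)] .
    note aD = U_D[OF aU]
    obtain u where u: "1 < u" "b = \<bar>a\<bar> * u" "d = \<bar>a\<bar> * (u - sgn a)"
      "\<And>p. prime p \<Longrightarrow> p dvd \<bar>a\<bar> \<longleftrightarrow> p dvd u"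
      using ordered_dep_pairs_structure[OF P assms(1)] by blast
    have e: "d div \<bar>a\<bar> = u - sgn a" using u(3) aD
      by (metis nonzero_mult_div_cancel_left not_one_less_zero)
    have "squarefree \<bar>a\<bar>" using assms(3) u(3) by (metis dvd_triv_left squarefree_mono)
    then have "\<bar>a\<bar> dvd u"
      using u(1,4) squarefree_dvd_if_prime_divisors_dvd[of "\<bar>a\<bar>" u] by fastforce
    then have "\<bar>a\<bar> \<le> u" using u(1) by (intro zdvd_imp_le) auto
    moreover have "sgn a \<le> 1" by (simp add: sgn_if)
    ultimately have "\<bar>a\<bar> - 1 \<le> d div \<bar>a\<bar>" using e by linarith
    \<comment> \<open>Equality would contradict coprimality, since both factors exceed 1.\<close>
    moreover have "d div \<bar>a\<bar> \<noteq> \<bar>a\<bar>" using aD by auto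
    moreover have "d div \<bar>a\<bar> \<noteq> \<bar>a\<bar> - 1" 
    proof
      assume *: "d div \<bar>a\<bar> = \<bar>a\<bar> - 1"
      have "d = \<bar>a\<bar> * (d div \<bar>a\<bar>)" using aD by blast
      then have "\<bar>a\<bar> \<in> R" unfolding * R_def using aD by blast
      then show False using \<open>\<bar>a\<bar> \<notin> R\<close> by blast
    qed
    ultimately show "\<bar>a\<bar> \<in> Q" using aU by (simp add: Q_def)
  qed
  have "card (ordered_dep_pairs d) \<le> card (Q \<union> R)"
    using inj img finQ R1 by (intro card_inj_on_le) auto
  also have "\<dots> \<le> card Q + 1" using card_Un_le[of Q R] R1 by linarith
  \<comment> \<open>The 2 contributed by \<open>R\<close> exactly offsets the two sets of primes
    excluded from the count of unitary divisors.\<close>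
  finally have "2 * card (ordered_dep_pairs d) \<le> 2 * card Q + 2" by simp
  also have "\<dots> \<le> (2 ^ card (prime_factors d) - 2) + 2" using twoQ U(2) by linarith
  also have "\<dots> = 2 ^ card (prime_factors d)"
    using assms(2) power_increasing[of 1 "card (prime_factors d)" "2 :: nat"] by simp
  finally show ?thesis .
qed

section \<open>Reduction to ordered pairs and final bounds\<close>

text \<open>The five explicit pairs come, in order, from \<open>a = 1\<close>,
  \<open>a = - 1\<close>, \<open>b = 1\<close>, \<open>b = - 1\<close> and
  \<open>a = - b\<close>.\<close>

lemma mult_dep_pairs_subset:
  "mult_dep_pairs d \<subseteq> {(1, 1 + d), (- 1, d - 1), (1 - d, 1), (- 1 - d, - 1), (- (d div 2), d div 2)}
     \<union> ordered_dep_pairs d \<union> (\<lambda>(a, b). (- b, - a)) ` ordered_dep_pairs d"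
  (is "_ \<subseteq> ?T \<union> ?P \<union> ?P'") if "0 < d"
proof (rule subrelI, rule ccontr)
  fix a b
  assume P: "(a, b) \<in> mult_dep_pairs d" and "(a, b) \<notin> ?T \<union> ?P \<union> ?P'"
  then have triv: "(a, b) \<notin> ?T" and not_P: "(a, b) \<notin> ?P" and not_img: "(a, b) \<notin> ?P'" by auto
  have ab: "mult_dependent a b" "a \<noteq> 0" "b \<noteq> 0" "b = a + d" using P by (auto simp: mult_dep_pairs_def)
  have "\<bar>a\<bar> \<noteq> \<bar>b\<bar>"
  proof
    assume "\<bar>a\<bar> = \<bar>b\<bar>"
    \<comment> \<open>The alternative \<open>a = b\<close> is excluded by
      \<open>0 < d\<close>.\<close>
    then have "b = - a" "d = 2 * b" using ab \<open>0 < d\<close> by linarith+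
    then show False using triv by auto
  qed
  moreover have "1 < \<bar>a\<bar>" "1 < \<bar>b\<bar>" using triv ab by auto
  moreover have "\<not> \<bar>b\<bar> < \<bar>a\<bar>"
  proof
    assume "\<bar>b\<bar> < \<bar>a\<bar>"
    then have "(- b, - a) \<in> ordered_dep_pairs d"
      using ab \<open>1 < \<bar>b\<bar>\<close> mult_dependent_uminus[of b a] mult_dependent_commute[of a b]
      by (auto simp: ordered_dep_pairs_def)
    then show False using not_img by force
  qed
  ultimately show False using ab not_P by (auto simp: ordered_dep_pairs_def)
qed

lemma M_le_ordered:
  assumes "0 < d" "3 \<le> card (prime_factors d)"
  shows "finite (mult_dep_pairs d)" and "M d \<le> 5 + 2 * card (ordered_dep_pairs d)"
proof -
  let ?T = "{(1, 1 + d), (- 1, d - 1), (1 - d, 1), (- 1 - d, - 1), (- (d div 2), d div 2)}"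
  let ?P = "ordered_dep_pairs d" and ?P' = "(\<lambda>(a, b). (- b, - a)) ` ordered_dep_pairs d"
  have fin: "finite ?P" using card_ordered_dep_pairs_le(1)[OF assms] .
  then have finU: "finite (?T \<union> ?P \<union> ?P')" by simp
  note sub = mult_dep_pairs_subset[OF assms(1)]
  show "finite (mult_dep_pairs d)" using sub finU by (rule finite_subset)
  have "M d \<le> card (?T \<union> ?P \<union> ?P')" unfolding M_def using finU sub by (rule card_mono)
  also have "\<dots> \<le> card ?T + card ?P + card ?P'"
    by (meson add_mono card_Un_le order_refl order_trans)
  also have "\<dots> \<le> 5 + card ?P + card ?P"
    using fin by (intro add_mono card_image_le card_insert_le_m1) auto
  finally show "M d \<le> 5 + 2 * card ?P" by simp
qed

theorem theorem4p4:
  fixes d :: int and m :: nat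
  assumes "d > 0" and "even d"
    and "m = card (prime_factors d)" and "m \<ge> 3"
  shows "finite (mult_dep_pairs d) \<and>
    M d \<le> 2 ^ (m + 1) + 1 \<and>
    (squarefree d \<longrightarrow>
      (m = 3 \<longrightarrow> M d \<le> 13) \<and>
      (m \<ge> 4 \<longrightarrow> int (M d) \<le> 2 ^ (m + 1) + 7 - 4 * int m))"
proof -
  have m: "3 \<le> card (prime_factors d)" using assms by simp
  note fin = M_le_ordered[OF assms(1) m]
  \<comment> \<open>Keeps the natural subtraction in \<open>5 + 2 * (2 ^ m - 2)\<close> from
    truncating.\<close>
  have pow: "(4 :: nat) \<le> 2 ^ m"
    using power_increasing[of 2 m "2 :: nat"] assms(4) by simp
  have general: "M d \<le> 2 ^ (m + 1) + 1"
    using fin(2) card_ordered_dep_pairs_le(2)[OF assms(1) m] pow assms(3) by simp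
  have sqf: "M d \<le> 5 + 2 ^ m" if "squarefree d"
    using fin(2) card_ordered_dep_pairs_squarefree_le[OF assms(1) m that] assms(3) by simp
  \<comment> \<open>This is what \<open>5 + 2 ^ m \<le> 2 ^ (m + 1) + 7 - 4 * m\<close> amounts to.
    It fails at \<open>m = 3\<close>, where \<open>5 + 2 ^ m\<close> is 13, hence the separate
    case.\<close>
  have growth: "4 * int m \<le> 2 ^ m + 2" if "4 \<le> m"
    using that by (induction m rule: dec_induct) auto
  have "int (M d) \<le> 2 ^ (m + 1) + 7 - 4 * int m" if "squarefree d" "4 \<le> m"
  proof -
    have "int (M d) \<le> int (5 + 2 ^ m)" using sqf[OF that(1)] by (rule of_nat_mono)
    then show ?thesis using growth[OF that(2)] by simp
  qed
  then show ?thesis using fin(1) general sqf by auto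
qed

end
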